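(* Let $0\le\gamma<\infty$. The restricted dual problem $$D^\star_\gamma=\sup_{\lambda\in\Lambda_\gamma}g(\lambda),\qquad \Lambda_\gamma=\{\lambda\in L^1_+(\mathcal D):\|\lambda\|_\infty\le\gamma\},$$ is the (Lagrangian) dual of the relaxed primal problem $$P^\star_\gamma=\min_{f_\theta\in\mathcal H,\;u\in L_1(\mathcal D)}\ \mathbb E_{\mathbf z\sim\mathcal D_0}[\ell_0(f_\theta,\mathbf z)]+\gamma\,\mathbb E_{\mathbf z\sim\mathcal D}[|u(\mathbf z)|]\quad\text{s.t.}\quad \ell(f_\theta,\mathbf z)\le u(\mathbf z)\ \ \mathcal D\text{-a.e.}$$ That is, $\sup_{\lambda\in L^1_+(\mathcal D)}g_\gamma(\lambda)=\sup_{\lambda\in\Lambda_\gamma}g(\lambda)$, where $g_\gamma(\lambda)=\inf_{f_\theta\in\mathcal H,\;u\in L_1(\mathcal D)}L_\gamma(f_\theta,u,\lambda)$ is the dual function of the relaxed primal problem, with Lagrangian $L_\gamma:\mathcal H\times L_1(\mathcal D)\times L^1_+(\mathcal D)\to\mathbb R$ given by $$L_\gamma(f_\theta,u,\lambda)=\mathbb E_{\mathbf z\sim\mathcal D_0}[\ell_0(f_\theta,\mathbf z)]+\gamma\,\mathbb E_{\mathbf z\sim\mathcal D}[|u(\mathbf z)|]+\mathbb E_{\mathbf z\sim\mathcal D}\big[\lambda(\mathbf z)\big(\ell(f_\theta,\mathbf z)-u(\mathbf z)\big)\big].$$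
   Context: $\mathcal X,\mathcal Y$ are the input and output spaces, $\mathcal Z=\mathcal X\times\mathcal Y$, and $\mathbf z=(\mathbf x,y)\in\mathcal Z$. $\mathcal D_0,\mathcal D$ are probability distributions on $\mathcal Z$. $\mathcal H=\{f_\theta:\theta\in\Theta\subseteq\mathbb R^p\}$ is a class of predictors $f_\theta:\mathcal X\to\mathcal Y$. The objective loss $\ell_0$ and the constraint loss $\ell$ are functions $\mathcal Y\times\mathcal Y\to[0,B]$, and the constraint threshold is normalized to $0$. Write $\ell(f_\theta,\mathbf z)=\ell(f_\theta(\mathbf x),y)$, and similarly for $\ell_0$. $L_1(\mathcal D)$ is the set of $\mathcal D$-integrable functions on $\mathcal Z$, $L^1_+(\mathcal D)$ the set of its nonnegative elements, and $\|\cdot\|_\infty$ the $L_\infty$ norm. The function $g:L^1_+(\mathcal D)\to\mathbb R$ is the dual function of the unrelaxed problem ($\min_{f_\theta\in\mathcal H}\mathbb E_{\mathbf z\sim\mathcal D_0}[\ell_0(f_\theta,\mathbf z)]$ s.t. $\ell(f_\theta,\mathbf z)\le 0$ $\mathcal D$-a.e.), namely $g(\lambda)=\min_{f_\theta\in\mathcal H}\{\mathbb E_{\mathbf z\sim\mathcal D_0}[\ell_0(f_\theta,\mathbf z)]+\mathbb E_{\mathbf z\sim\mathcal D}[\lambda(\mathbf z)\ell(f_\theta,\mathbf z)]\}$. *)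

theory Defs
  imports "HOL-Probability.Probability"
begin

definition loss_at :: "('y \<Rightarrow> 'y \<Rightarrow> real) \<Rightarrow> ('x \<Rightarrow> 'y) \<Rightarrow> 'x \<times> 'y \<Rightarrow> real" where
  "loss_at l h z = l (h (fst z)) (snd z)"

text \<open>
  Elements of \<open>L\<^sub>1(D)\<close> are represented by integrable functions rather than by classes modulo
  null sets, so their order and their \<open>L\<^sub>\<infinity>\<close> norm are the almost-everywhere ones.
\<close>

definition L1 :: "'z measure \<Rightarrow> ('z \<Rightarrow> real) set" where
  "L1 D = {u. integrable D u}"

definition L1_plus :: "'z measure \<Rightarrow> ('z \<Rightarrow> real) set" where
  "L1_plus D = {lam \<in> L1 D. AE z in D. 0 \<le> lam z}"

definition Linf_norm :: "'z measure \<Rightarrow> ('z \<Rightarrow> real) \<Rightarrow> ereal" where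
  "Linf_norm D lam = esssup D (\<lambda>z. ereal \<bar>lam z\<bar>)"

definition restricted_multipliers :: "'z measure \<Rightarrow> real \<Rightarrow> ('z \<Rightarrow> real) set" where
  "restricted_multipliers D \<gamma> = {lam \<in> L1_plus D. Linf_norm D lam \<le> ereal \<gamma>}"

text \<open>
  Optimal values are infima and suprema in the extended reals: minima need not be attained, and
  the dual function of the relaxed problem takes the value \<open>-\<infinity>\<close>.
\<close>

definition dual_function ::
  "('x \<times> 'y) measure \<Rightarrow> ('x \<times> 'y) measure \<Rightarrow> ('x \<Rightarrow> 'y) set \<Rightarrow>
   ('y \<Rightarrow> 'y \<Rightarrow> real) \<Rightarrow> ('y \<Rightarrow> 'y \<Rightarrow> real) \<Rightarrow> ('x \<times> 'y \<Rightarrow> real) \<Rightarrow> ereal" where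
  "dual_function D0 D H l0 l lam =
     (INF h\<in>H. ereal ((\<integral>z. loss_at l0 h z \<partial>D0) + (\<integral>z. lam z * loss_at l h z \<partial>D)))"

text \<open>
  The product of two integrable functions need not be integrable; where \<open>lam * u\<close> is not, the last
  integral below is \<open>0\<close> by the convention of the Bochner integral. This happens only if \<open>lam\<close> is
  not essentially bounded; the infimum over \<open>u\<close> is then \<open>-\<infinity>\<close> for every predictor, already along
  bounded \<open>u\<close> vanishing where \<open>lam\<close> is large, for which all terms are integrable.
\<close>

definition relaxed_lagrangian ::
  "('x \<times> 'y) measure \<Rightarrow> ('x \<times> 'y) measure \<Rightarrow> ('y \<Rightarrow> 'y \<Rightarrow> real) \<Rightarrow> ('y \<Rightarrow> 'y \<Rightarrow> real) \<Rightarrow> real \<Rightarrow>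
   ('x \<Rightarrow> 'y) \<Rightarrow> ('x \<times> 'y \<Rightarrow> real) \<Rightarrow> ('x \<times> 'y \<Rightarrow> real) \<Rightarrow> real" where
  "relaxed_lagrangian D0 D l0 l \<gamma> h u lam =
     (\<integral>z. loss_at l0 h z \<partial>D0) + \<gamma> * (\<integral>z. \<bar>u z\<bar> \<partial>D)
       + (\<integral>z. lam z * (loss_at l h z - u z) \<partial>D)"

definition relaxed_dual_function ::
  "('x \<times> 'y) measure \<Rightarrow> ('x \<times> 'y) measure \<Rightarrow> ('x \<Rightarrow> 'y) set \<Rightarrow>
   ('y \<Rightarrow> 'y \<Rightarrow> real) \<Rightarrow> ('y \<Rightarrow> 'y \<Rightarrow> real) \<Rightarrow> real \<Rightarrow> ('x \<times> 'y \<Rightarrow> real) \<Rightarrow> ereal" where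
  "relaxed_dual_function D0 D H l0 l \<gamma> lam =
     (INF (h, u)\<in>H \<times> L1 D. ereal (relaxed_lagrangian D0 D l0 l \<gamma> h u lam))"

end

theory Submission imports Defs begin

text \<open>
  In the relaxed Lagrangian \<open>u\<close> enters only through \<open>E[\<gamma> \<bar>u\<bar> - lam u]\<close>. If \<open>lam \<le> \<gamma>\<close> almost
  everywhere this is nonnegative and vanishes at \<open>u = 0\<close>, so both dual functions agree at \<open>lam\<close>.
  Otherwise the choice \<open>u = t * 1{lam > \<gamma>}\<close> with \<open>t \<rightarrow> \<infinity>\<close> makes the relaxed dual function \<open>-\<infinity>\<close>,
  and such \<open>lam\<close> do not contribute to the supremum.
\<close>

text \<open>The essential supremum is itself an almost-everywhere bound, and it is the least one.
  Measurability enters in the second half: \<open>esssup\<close> of a non-measurable function is the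
  top element.\<close>

lemma Linf_norm_le_iff:
  assumes [measurable]: "lam \<in> borel_measurable D"
  shows "Linf_norm D lam \<le> ereal c \<longleftrightarrow> (AE z in D. \<bar>lam z\<bar> \<le> c)"
proof
  assume le: "Linf_norm D lam \<le> ereal c"
  have "AE z in D. ereal \<bar>lam z\<bar> \<le> esssup D (\<lambda>z. ereal \<bar>lam z\<bar>)"
    by (rule esssup_AE)
  then show "AE z in D. \<bar>lam z\<bar> \<le> c"
  proof eventually_elim
    case (elim z)
    then have "ereal \<bar>lam z\<bar> \<le> ereal c"
      using le unfolding Linf_norm_def by (rule order_trans)
    then show ?case by simp
  qed
next
  assume "AE z in D. \<bar>lam z\<bar> \<le> c"
  then show "Linf_norm D lam \<le> ereal c"
    unfolding Linf_norm_def by (intro esssup_I) auto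
qed

lemma restricted_multipliers_iff:
  "lam \<in> restricted_multipliers D \<gamma> \<longleftrightarrow> lam \<in> L1_plus D \<and> (AE z in D. lam z \<le> \<gamma>)"
proof (cases "lam \<in> L1_plus D")
  case True
  then have [measurable]: "lam \<in> borel_measurable D" and nonneg: "AE z in D. 0 \<le> lam z"
    by (auto simp: L1_plus_def L1_def)
  have "(AE z in D. \<bar>lam z\<bar> \<le> \<gamma>) \<longleftrightarrow> (AE z in D. lam z \<le> \<gamma>)"
    by (rule eventually_cong[OF nonneg]) auto
  with True show ?thesis
    by (simp add: restricted_multipliers_def Linf_norm_le_iff)
qed (simp add: restricted_multipliers_def)

lemma zero_in_restricted_multipliers:
  "0 \<le> \<gamma> \<Longrightarrow> (\<lambda>_. 0) \<in> restricted_multipliers D \<gamma>"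
  by (simp add: restricted_multipliers_iff L1_plus_def L1_def)

text \<open>Domination by \<open>c * f\<close>. The bounded factor is \<open>lam\<close> when the
  other one is \<open>u\<close>, and the loss when the other one is \<open>lam\<close>.\<close>

lemma integrable_mult_AE_bounded:
  fixes f g :: "'a \<Rightarrow> real"
  assumes "integrable M f" and "g \<in> borel_measurable M" and "AE z in M. \<bar>g z\<bar> \<le> c"
  shows "integrable M (\<lambda>z. f z * g z)"
proof (rule Bochner_Integration.integrable_bound)
  show "integrable M (\<lambda>z. c * f z)"
    using assms(1) by simp
  show "(\<lambda>z. f z * g z) \<in> borel_measurable M"
    using assms(1,2) by measurable
  show "AE z in M. norm (f z * g z) \<le> norm (c * f z)"
    using assms(3)
  proof eventually_elim
    case (elim z)
    then have "\<bar>f z\<bar> * \<bar>g z\<bar> \<le> \<bar>f z\<bar> * \<bar>c\<bar>"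
      by (intro mult_left_mono) auto
    then show ?case by (simp add: abs_mult mult.commute)
  qed
qed

lemma relaxed_lagrangian_zero:
  "relaxed_lagrangian D0 D l0 l \<gamma> h (\<lambda>_. 0) lam
     = (\<integral>z. loss_at l0 h z \<partial>D0) + (\<integral>z. lam z * loss_at l h z \<partial>D)"
  by (simp add: relaxed_lagrangian_def)

text \<open>The choice \<open>u = 0\<close> is always available and turns the relaxed Lagrangian
  into the unrelaxed one.\<close>

lemma relaxed_dual_function_le_dual_function:
  "relaxed_dual_function D0 D H l0 l \<gamma> lam \<le> dual_function D0 D H l0 l lam"
  unfolding dual_function_def
proof (rule INF_greatest)
  fix h assume "h \<in> H"
  then have "(h, \<lambda>_. 0) \<in> H \<times> L1 D"
    by (simp add: L1_def)
  from INF_lower[OF this, of "\<lambda>(h, u). ereal (relaxed_lagrangian D0 D l0 l \<gamma> h u lam)"]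
  show "relaxed_dual_function D0 D H l0 l \<gamma> lam
      \<le> ereal ((\<integral>z. loss_at l0 h z \<partial>D0) + (\<integral>z. lam z * loss_at l h z \<partial>D))"
    by (simp add: relaxed_dual_function_def relaxed_lagrangian_zero)
qed

text \<open>Collects the dependence on \<open>u\<close> in one integral, whose sign decides
  everything below. Integrability of both products is what makes the Bochner integral split.\<close>

lemma relaxed_lagrangian_eq:
  assumes "integrable D (\<lambda>z. lam z * loss_at l h z)" and "integrable D (\<lambda>z. lam z * u z)"
    and "integrable D u"
  shows "relaxed_lagrangian D0 D l0 l \<gamma> h u lam
    = (\<integral>z. loss_at l0 h z \<partial>D0) + (\<integral>z. lam z * loss_at l h z \<partial>D)
      + (\<integral>z. \<gamma> * \<bar>u z\<bar> - lam z * u z \<partial>D)"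
  using assms by (simp add: relaxed_lagrangian_def right_diff_distrib)

text \<open>The bound on \<open>lam\<close> serves twice: it makes \<open>lam * u\<close>
  integrable, so that the Lagrangian splits, and it lets the penalty
  \<open>\<gamma> * \<bar>u\<bar>\<close> dominate \<open>lam * u\<close>.\<close>

lemma dual_function_le_relaxed_dual_function:
  assumes lam: "lam \<in> restricted_multipliers D \<gamma>"
    and loss: "\<And>h. h \<in> H \<Longrightarrow> integrable D (\<lambda>z. lam z * loss_at l h z)"
  shows "dual_function D0 D H l0 l lam \<le> relaxed_dual_function D0 D H l0 l \<gamma> lam"
  unfolding relaxed_dual_function_def
proof (rule INF_greatest, clarify)
  fix h u assume h: "h \<in> H" and "u \<in> L1 D"
  then have u: "integrable D u"
    by (simp add: L1_def)
  have lam_meas: "lam \<in> borel_measurable D" and nonneg: "AE z in D. 0 \<le> lam z"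
    and le: "AE z in D. lam z \<le> \<gamma>"
    using lam by (auto simp: restricted_multipliers_iff L1_plus_def L1_def)
  have bound: "AE z in D. \<bar>lam z\<bar> \<le> \<gamma>"
    using nonneg le by eventually_elim simp
  have int: "integrable D (\<lambda>z. lam z * u z)"
    using integrable_mult_AE_bounded[OF u lam_meas bound] by (simp add: mult.commute)
  have "0 \<le> (\<integral>z. \<gamma> * \<bar>u z\<bar> - lam z * u z \<partial>D)"
  proof (rule integral_nonneg_AE)
    show "AE z in D. 0 \<le> \<gamma> * \<bar>u z\<bar> - lam z * u z"
      using bound
    proof eventually_elim
      case (elim z)
      have "lam z * u z \<le> \<bar>lam z\<bar> * \<bar>u z\<bar>"
        by (metis abs_ge_self abs_mult)
      also have "\<dots> \<le> \<gamma> * \<bar>u z\<bar>"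
        using elim by (intro mult_right_mono) auto
      finally show ?case by simp
    qed
  qed
  then have "ereal ((\<integral>z. loss_at l0 h z \<partial>D0) + (\<integral>z. lam z * loss_at l h z \<partial>D))
      \<le> ereal (relaxed_lagrangian D0 D l0 l \<gamma> h u lam)"
    using relaxed_lagrangian_eq[OF loss[OF h] int u] by simp
  then show "dual_function D0 D H l0 l lam \<le> ereal (relaxed_lagrangian D0 D l0 l \<gamma> h u lam)"
    unfolding dual_function_def by (rule INF_lower2[OF h])
qed

text \<open>One predictor \<open>h\<close> suffices: along \<open>u = t * 1{lam > \<gamma>}\<close>
  the Lagrangian is affine in \<open>t\<close> with negative slope. Finiteness of \<open>D\<close>
  makes these bounded \<open>u\<close> integrable.\<close>

lemma relaxed_dual_function_eq_minus_infinity: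
  assumes "finite_measure D" and lam: "lam \<in> L1_plus D" "lam \<notin> restricted_multipliers D \<gamma>"
    and h: "h \<in> H" and loss: "integrable D (\<lambda>z. lam z * loss_at l h z)"
  shows "relaxed_dual_function D0 D H l0 l \<gamma> lam = -\<infinity>"
proof -
  interpret finite_measure D by fact
  have int: "integrable D lam"
    using lam(1) by (simp add: L1_plus_def L1_def)
  then have [measurable]: "lam \<in> borel_measurable D" by simp
  define A where "A = {z \<in> space D. \<gamma> < lam z}"
  have A [measurable]: "A \<in> sets D"
    unfolding A_def by measurable
  \<comment> \<open>The excess of \<open>lam\<close> over \<open>\<gamma>\<close>. Its integral
    \<open>c\<close> is the rate at which the Lagrangian falls as \<open>t\<close> grows, starting
    from its value \<open>K\<close> at \<open>u = 0\<close>.\<close>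
  let ?w = "\<lambda>z. (lam z - \<gamma>) * indicator A z"
  have w_int: "integrable D ?w"
    using int by (intro integrable_real_mult_indicator) auto
  have w_nonneg: "AE z in D. 0 \<le> ?w z"
    by (auto simp: A_def indicator_def)
  have "(\<integral>z. ?w z \<partial>D) \<noteq> 0"
  proof
    assume "(\<integral>z. ?w z \<partial>D) = 0"
    then have "AE z in D. ?w z = 0"
      using integral_nonneg_eq_0_iff_AE[OF w_int w_nonneg] by simp
    then have "AE z in D. lam z \<le> \<gamma>"
      using AE_space
    proof eventually_elim
      case (elim z)
      then show ?case by (auto simp: A_def indicator_def split: if_splits)
    qed
    with lam show False by (simp add: restricted_multipliers_iff)
  qed
  then have c_pos: "0 < (\<integral>z. ?w z \<partial>D)"
    using integral_nonneg_AE[OF w_nonneg] by linarith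
  define c where "c = (\<integral>z. ?w z \<partial>D)"
  define K where "K = (\<integral>z. loss_at l0 h z \<partial>D0) + (\<integral>z. lam z * loss_at l h z \<partial>D)"
  have upper: "relaxed_dual_function D0 D H l0 l \<gamma> lam \<le> ereal (K - t * c)" if "0 \<le> t" for t
  proof -
    let ?u = "\<lambda>z. t * indicator A z :: real"
    have u: "integrable D ?u"
      using A by (intro integrable_mult_right integrable_real_indicator) (auto simp: less_top[symmetric])
    have "integrable D (\<lambda>z. t * (lam z * indicator A z))"
      using int A by (intro integrable_mult_right integrable_real_mult_indicator)
    then have lam_u: "integrable D (\<lambda>z. lam z * ?u z)"
      by (simp add: mult.left_commute)
    \<comment> \<open>Since \<open>0 \<le> t\<close>, the absolute value of \<open>?u\<close> is
      \<open>?u\<close> itself.\<close>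
    have "(\<integral>z. \<gamma> * \<bar>?u z\<bar> - lam z * ?u z \<partial>D) = (\<integral>z. - t * ?w z \<partial>D)"
      using that by (intro Bochner_Integration.integral_cong)
        (auto simp: indicator_def algebra_simps)
    also have "\<dots> = - t * c"
      unfolding c_def by (rule integral_mult_right_zero)
    finally have "relaxed_lagrangian D0 D l0 l \<gamma> h ?u lam = K - t * c"
      using relaxed_lagrangian_eq[OF loss lam_u u] by (simp add: K_def)
    moreover have "(h, ?u) \<in> H \<times> L1 D"
      using h u by (simp add: L1_def)
    from INF_lower[OF this, of "\<lambda>(h, u). ereal (relaxed_lagrangian D0 D l0 l \<gamma> h u lam)"]
    have "relaxed_dual_function D0 D H l0 l \<gamma> lam
        \<le> ereal (relaxed_lagrangian D0 D l0 l \<gamma> h ?u lam)"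
      by (simp add: relaxed_dual_function_def)
    ultimately show ?thesis by simp
  qed
  have "relaxed_dual_function D0 D H l0 l \<gamma> lam \<le> ereal x" for x
  proof -
    \<comment> \<open>With this choice \<open>t * c = \<bar>K - x\<bar>\<close>, which is enough to
      bring \<open>K - t * c\<close> down to \<open>x\<close>.\<close>
    define t where "t = \<bar>K - x\<bar> / c"
    have "0 < c" using c_pos by (simp add: c_def)
    then have "0 \<le> t" "K - t * c \<le> x" by (auto simp: t_def)
    then show ?thesis
      using upper[of t] by (meson ereal_less_eq(3) order_trans)
  qed
  then show ?thesis by (rule ereal_bot)
qed

theorem proposition1:
  fixes X :: "'x set" and Y :: "'y set"
    and D0 D :: "('x \<times> 'y) measure"
    and \<Theta> :: "(real ^ 'p) set" and f :: "real ^ 'p \<Rightarrow> 'x \<Rightarrow> 'y"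
    and H :: "('x \<Rightarrow> 'y) set"
    and l0 l :: "'y \<Rightarrow> 'y \<Rightarrow> real" and B \<gamma> :: real
  assumes "prob_space D0" and "space D0 = X \<times> Y"
    and "prob_space D" and "space D = X \<times> Y"
    and "\<And>\<theta>. \<theta> \<in> \<Theta> \<Longrightarrow> f \<theta> \<in> X \<rightarrow> Y"
    and "H = f ` \<Theta>"
    and "\<And>y y'. y \<in> Y \<Longrightarrow> y' \<in> Y \<Longrightarrow> l0 y y' \<in> {0..B}"
    and "\<And>y y'. y \<in> Y \<Longrightarrow> y' \<in> Y \<Longrightarrow> l y y' \<in> {0..B}"
    and "\<And>\<theta>. \<theta> \<in> \<Theta> \<Longrightarrow> loss_at l0 (f \<theta>) \<in> borel_measurable D0"
    and "\<And>\<theta>. \<theta> \<in> \<Theta> \<Longrightarrow> loss_at l (f \<theta>) \<in> borel_measurable D"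
    and "0 \<le> \<gamma>"
  shows "(SUP lam\<in>L1_plus D. relaxed_dual_function D0 D H l0 l \<gamma> lam)
       = (SUP lam\<in>restricted_multipliers D \<gamma>. dual_function D0 D H l0 l lam)"
proof (rule antisym)
  interpret D: prob_space D by fact
  \<comment> \<open>Predictors map \<open>X\<close> into \<open>Y\<close>, so on the space of
    \<open>D\<close> the loss takes values in \<open>[0, B]\<close>.\<close>
  have loss: "integrable D (\<lambda>z. lam z * loss_at l h z)" if "lam \<in> L1_plus D" "h \<in> H" for lam h
  proof (rule integrable_mult_AE_bounded)
    from that(2) assms(6) obtain \<theta> where \<theta>: "\<theta> \<in> \<Theta>" "h = f \<theta>" by blast
    show "integrable D lam"
      using that(1) by (simp add: L1_plus_def L1_def)
    show "loss_at l h \<in> borel_measurable D"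
      using assms(10) \<theta> by simp
    show "AE z in D. \<bar>loss_at l h z\<bar> \<le> B"
    proof (rule AE_I2)
      fix z assume "z \<in> space D"
      then have "snd z \<in> Y" "h (fst z) \<in> Y"
        using assms(4) assms(5)[OF \<theta>(1)] \<theta>(2) by auto
      then show "\<bar>loss_at l h z\<bar> \<le> B"
        using assms(8)[of "h (fst z)" "snd z"] by (simp add: loss_at_def)
    qed
  qed
  show "(SUP lam\<in>L1_plus D. relaxed_dual_function D0 D H l0 l \<gamma> lam)
      \<le> (SUP lam\<in>restricted_multipliers D \<gamma>. dual_function D0 D H l0 l lam)" (is "_ \<le> ?S")
  proof (rule SUP_least)
    fix lam assume lam: "lam \<in> L1_plus D"
    consider "H = {}" | "lam \<in> restricted_multipliers D \<gamma>"
      | h where "h \<in> H" "lam \<notin> restricted_multipliers D \<gamma>" by blast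
    then show "relaxed_dual_function D0 D H l0 l \<gamma> lam \<le> ?S"
    proof cases
      \<comment> \<open>Infima over the empty class are \<open>\<infinity>\<close>, so
        \<open>?S\<close> is \<open>\<infinity>\<close> as soon as the restricted set has an
        element; the zero multiplier is one because \<open>0 \<le> \<gamma>\<close>.\<close>
      case 1
      then show ?thesis
        using zero_in_restricted_multipliers[OF assms(11)]
        by (intro SUP_upper2[where i="\<lambda>_. 0"]) (simp_all add: dual_function_def)
    next
      case 2
      then show ?thesis
        by (rule SUP_upper2) (rule relaxed_dual_function_le_dual_function)
    next
      case 3
      then show ?thesis
        using relaxed_dual_function_eq_minus_infinity[OF D.finite_measure_axioms lam]
          loss[OF lam] by simp
    qed
  qed
  show "?S \<le> (SUP lam\<in>L1_plus D. relaxed_dual_function D0 D H l0 l \<gamma> lam)"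
  proof (rule SUP_mono)
    fix lam assume lam: "lam \<in> restricted_multipliers D \<gamma>"
    then have "lam \<in> L1_plus D" by (simp add: restricted_multipliers_iff)
    \<comment> \<open>The witness is \<open>lam\<close> itself.\<close>
    with lam loss show "\<exists>m\<in>L1_plus D.
        dual_function D0 D H l0 l lam \<le> relaxed_dual_function D0 D H l0 l \<gamma> m"
      by (blast intro: dual_function_le_relaxed_dual_function)
  qed
qed

end
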